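(* Let $\mathcal{T}\subset I\times J\times I\times J$ be a finite set of Wang tiles having horizontal and vertical stripes, with associated partition $\mathcal{T}=\mathcal{T}_{00}\cup\mathcal{T}_{01}\cup\mathcal{T}_{10}\cup\mathcal{T}_{11}$. Suppose that $\mathcal{T}$ determines the quadrilateral $ABDC$ for some integer points $A=(A_1,A_2)$, $B=(B_1,B_2)$, $C=(C_1,C_2)$, $D=(D_1,D_2)\in\mathbb{Z}^2$. If $$\det\begin{pmatrix} A_1 & D_1 \\ A_2 & D_2 \end{pmatrix}=0,\qquad \det\begin{pmatrix} B_1 & D_1 \\ B_2 & D_2 \end{pmatrix}=-\det\begin{pmatrix} C_1 & D_1 \\ C_2 & D_2 \end{pmatrix}\neq 0,$$ and there exists $i\in\{1,2\}$ such that $(B_i+C_i)^2-4A_iD_i>0$ is not a perfect square, then $\mathcal{T}$ admits no periodic tiling, i.e. no valid configuration $w:\mathbb{Z}^2\to\mathcal{T}$ is periodic.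
   Context: Wang tiles. Let $I$ (vertical colors) and $J$ (horizontal colors) be finite sets. A Wang tile is a tuple $\tau=(a,b,c,d)\in I\times J\times I\times J$, where $a,b,c,d$ are the labels of the right (east), top (north), left (west) and bottom (south) edges of a unit square. For a finite set $\mathcal{T}$ of Wang tiles, a configuration $w:\mathbb{Z}^2\to\mathcal{T}$ is valid if for all $n\in\mathbb{Z}^2$ the east label of $w_n$ equals the west label of $w_{n+(1,0)}$ and the north label of $w_n$ equals the south label of $w_{n+(0,1)}$. It is periodic if there is $p\in\mathbb{Z}^2\setminus\{0\}$ with $w_{n+p}=w_n$ for all $n$. Stripes. $\mathcal{T}$ has horizontal and vertical stripes if there are partitions $I=I_0\sqcup I_1$ and $J=J_0\sqcup J_1$ such that every $(a,b,c,d)\in\mathcal{T}$ has $a,c$ in the same part of $I$ and $b,d$ in the same part of $J$. Then $\mathcal{T}_{xy}=\mathcal{T}\cap(I_x\times J_y\times I_x\times J_y)$ for $x,y\in\{0,1\}$ ($x=1$: horizontal stripe present; $y=1$: vertical stripe present). Quadrilateral. $\mathcal{T}$ determines the quadrilateral $ABDC$ ($A,B,C,D\in\mathbb{R}^2$, possibly degenerate) if there are maps $v:I\to\mathbb{R}^2$ and $h:J\to\mathbb{R}^2$ such that for every $\tau=(a,b,c,d)\in\mathcal{T}$, the vector $v(a)+h(b)-v(c)-h(d)$ equals $A$ if $\tau\in\mathcal{T}_{00}$, $B$ if $\tau\in\mathcal{T}_{10}$, $C$ if $\tau\in\mathcal{T}_{01}$, and $D$ if $\tau\in\mathcal{T}_{11}$.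 *)

theory Defs
  imports "HOL-Analysis.Analysis" "HOL-Computational_Algebra.Nth_Powers"
begin

(* A tile (a, b, c, d) lists its labels in the order east, north, west, south. *)
type_synonym ('i, 'j) tile = "'i \<times> 'j \<times> 'i \<times> 'j"

fun east :: "('i, 'j) tile \<Rightarrow> 'i" where "east (a, b, c, d) = a"
fun north :: "('i, 'j) tile \<Rightarrow> 'j" where "north (a, b, c, d) = b"
fun west :: "('i, 'j) tile \<Rightarrow> 'i" where "west (a, b, c, d) = c"
fun south :: "('i, 'j) tile \<Rightarrow> 'j" where "south (a, b, c, d) = d"

definition valid_config :: "('i, 'j) tile set \<Rightarrow> (int \<times> int \<Rightarrow> ('i, 'j) tile) \<Rightarrow> bool" where
  "valid_config T w \<longleftrightarrow>
     (\<forall>n. w n \<in> T) \<and>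
     (\<forall>n. east (w n) = west (w (n + (1, 0))) \<and> north (w n) = south (w (n + (0, 1))))"

definition periodic_config :: "(int \<times> int \<Rightarrow> ('i, 'j) tile) \<Rightarrow> bool" where
  "periodic_config w \<longleftrightarrow> (\<exists>p. p \<noteq> 0 \<and> (\<forall>n. w (n + p) = w n))"

(* The parts of a partition are allowed to be empty. *)
definition has_stripes ::
    "'i set \<Rightarrow> 'i set \<Rightarrow> 'i set \<Rightarrow> 'j set \<Rightarrow> 'j set \<Rightarrow> 'j set \<Rightarrow> ('i, 'j) tile set \<Rightarrow> bool" where
  "has_stripes I I0 I1 J J0 J1 T \<longleftrightarrow>
     I = I0 \<union> I1 \<and> I0 \<inter> I1 = {} \<and> J = J0 \<union> J1 \<and> J0 \<inter> J1 = {} \<and>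
     (\<forall>(a, b, c, d) \<in> T.
        (a \<in> I0 \<and> c \<in> I0 \<or> a \<in> I1 \<and> c \<in> I1) \<and>
        (b \<in> J0 \<and> d \<in> J0 \<or> b \<in> J1 \<and> d \<in> J1))"

definition subtiles :: "('i, 'j) tile set \<Rightarrow> 'i set \<Rightarrow> 'j set \<Rightarrow> ('i, 'j) tile set" where
  "subtiles T Ix Jy = T \<inter> (Ix \<times> Jy \<times> Ix \<times> Jy)"

(* T_xy is subtiles T Ix Jy, so the points A, B, C, D belong to T_00, T_10, T_01, T_11.
   Only the values of v on I and of h on J matter when T is contained in I x J x I x J. *)
definition determines_quadrilateral ::
    "'i set \<Rightarrow> 'i set \<Rightarrow> 'j set \<Rightarrow> 'j set \<Rightarrow> ('i, 'j) tile set \<Rightarrow>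
     real^2 \<Rightarrow> real^2 \<Rightarrow> real^2 \<Rightarrow> real^2 \<Rightarrow> bool" where
  "determines_quadrilateral I0 I1 J0 J1 T A B C D \<longleftrightarrow>
     (\<exists>(v :: 'i \<Rightarrow> real^2) (h :: 'j \<Rightarrow> real^2).
        (\<forall>(a, b, c, d) \<in> subtiles T I0 J0. v a + h b - v c - h d = A) \<and>
        (\<forall>(a, b, c, d) \<in> subtiles T I1 J0. v a + h b - v c - h d = B) \<and>
        (\<forall>(a, b, c, d) \<in> subtiles T I0 J1. v a + h b - v c - h d = C) \<and>
        (\<forall>(a, b, c, d) \<in> subtiles T I1 J1. v a + h b - v c - h d = D))"

definition int_point :: "int^2 \<Rightarrow> real^2" where
  "int_point P = (\<chi> i. of_int (P $ i))"

(* The matrix with columns P and Q. *)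
definition cols2 :: "int^2 \<Rightarrow> int^2 \<Rightarrow> int^2^2" where
  "cols2 P Q = vector [vector [P $ 1, Q $ 1], vector [P $ 2, Q $ 2]]"

end

theory Submission
  imports Defs
begin

text \<open>Stripes never end, so the type of a tile is determined by a bit of its row and a bit of its
  column. Summing v(a) + h(b) - v(c) - h(d) over a rectangle telescopes to boundary terms. For a
  periodic configuration some q by L rectangle has total 0: if one coordinate of the period
  vanishes, pigeonhole gives a rectangle with matching opposite sides; otherwise the bits
  themselves are doubly periodic, so that the total grows quadratically under dilation unless it
  is zero, while the boundary terms grow linearly. Let m of the q rows and n of the L columns carry
  a stripe. Taking the determinant of the total with D yields m/q = n/L, after which
  (q - m, m) is a nontrivial integer zero of the form A_i X^2 + (B_i + C_i) X Y + D_i Y^2, whose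
  discriminant is therefore a perfect square.\<close>

section \<open>Binary quadratic forms and rectangle totals\<close>

lemma is_square_discriminant:
  fixes a s d x y :: int
  assumes zero: "a * x\<^sup>2 + s * x * y + d * y\<^sup>2 = 0" and nz: "x \<noteq> 0 \<or> y \<noteq> 0"
  shows "is_square (s\<^sup>2 - 4 * a * d)"
proof (cases "y = 0")
  case True
  then have "a = 0" using zero nz by simp
  then show ?thesis by simp
next
  case False
  \<comment> \<open>Completing the square after multiplication by \<open>4 * a\<close> needs no
    division, so \<open>a = 0\<close> is covered too.\<close>
  have "(2 * a * x + s * y)\<^sup>2 - (s\<^sup>2 - 4 * a * d) * y\<^sup>2 = 4 * a * (a * x\<^sup>2 + s * x * y + d * y\<^sup>2)"
    by (simp add: power2_eq_square algebra_simps)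
  then have eq: "(2 * a * x + s * y)\<^sup>2 = (s\<^sup>2 - 4 * a * d) * y\<^sup>2" using zero by simp
  then have "y\<^sup>2 dvd (2 * a * x + s * y)\<^sup>2" by simp
  then have "y dvd 2 * a * x + s * y" by simp
  then obtain z where z: "2 * a * x + s * y = y * z" by (rule dvdE)
  have "z\<^sup>2 = s\<^sup>2 - 4 * a * d"
    using eq False unfolding z by (simp add: power_mult_distrib mult.commute)
  then show ?thesis using is_nth_power_nth_power[of 2 z] by simp
qed

text \<open>The total of the labels a, b, c, d over q rows and L columns, of which m rows and n columns
  carry a stripe.\<close>

definition stripe_total :: "'a::comm_ring_1 \<Rightarrow> 'a \<Rightarrow> 'a \<Rightarrow> 'a \<Rightarrow> 'a \<Rightarrow> 'a \<Rightarrow> 'a \<Rightarrow> 'a \<Rightarrow> 'a" where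
  "stripe_total a b c d q L m n =
     (q - m) * (L - n) * a + m * (L - n) * b + (q - m) * n * c + m * n * d"

text \<open>When \<open>r j\<close> and \<open>k i\<close> are bits, the summand is the label of a
  single tile. Since \<open>stripe_total\<close> is bilinear in \<open>(q, m)\<close> and
  \<open>(L, n)\<close>, it can be summed along one direction at a time.\<close>

lemma sum_stripe_total:
  "(\<Sum>i<L. \<Sum>j<q. stripe_total a b c d 1 1 (r j) (k i)) =
     stripe_total a b c d (of_nat q) (of_nat L) (sum r {..<q}) (sum k {..<L})"
proof -
  have "(\<Sum>j<q. stripe_total a b c d 1 1 (r j) t) =
          stripe_total a b c d (of_nat q) 1 (sum r {..<q}) t" for t
    by (induction q) (simp_all add: stripe_total_def algebra_simps)
  moreover have "(\<Sum>i<L. stripe_total a b c d s 1 u (k i)) =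
                   stripe_total a b c d s (of_nat L) u (sum k {..<L})" for s u
    by (induction L) (simp_all add: stripe_total_def algebra_simps)
  ultimately show ?thesis by simp
qed

lemma of_int_stripe_total:
  "of_int (stripe_total a b c d q L m n) =
     stripe_total (of_int a) (of_int b) (of_int c) (of_int d)
       (of_int q) (of_int L) (of_int m) (of_int n)"
  by (simp add: stripe_total_def)

lemma stripe_total_scale:
  "stripe_total a b c d (s * q) (s * L) (s * m) (s * n) = s\<^sup>2 * stripe_total a b c d q L m n"
  by (simp add: stripe_total_def power2_eq_square algebra_simps)

lemma is_square_if_stripe_total_zero:
  fixes A B C D :: "int^2"
  assumes zero: "\<And>e. stripe_total (A $ e) (B $ e) (C $ e) (D $ e) q L m n = 0"
    and pos: "q > 0" "L > 0"
    and AD: "det (cols2 A D) = 0"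
    and BC: "det (cols2 B D) = - det (cols2 C D)"
    and CD: "det (cols2 C D) \<noteq> 0"
  shows "is_square ((B $ e + C $ e)\<^sup>2 - 4 * A $ e * D $ e)"
proof -
  have det: "det (cols2 P D) = P $ 1 * D $ 2 - D $ 1 * P $ 2" for P
    by (simp add: cols2_def det_2)
  \<comment> \<open>The determinant with \<open>D\<close> is linear in its first column, so it
    carries the vanishing total of the points to a total of determinants. Those of \<open>A\<close>
    and \<open>D\<close> are 0 and those of \<open>B\<close> and \<open>C\<close> are opposite,
    which leaves a multiple of \<open>det (cols2 C D)\<close>.\<close>
  have "stripe_total (det (cols2 A D)) (det (cols2 B D)) (det (cols2 C D)) (det (cols2 D D)) q L m n =
      stripe_total (A $ 1) (B $ 1) (C $ 1) (D $ 1) q L m n * D $ 2 -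
      stripe_total (A $ 2) (B $ 2) (C $ 2) (D $ 2) q L m n * D $ 1"
    unfolding det stripe_total_def by (simp add: algebra_simps)
  also have "\<dots> = 0" using zero by simp
  finally have "((q - m) * n - m * (L - n)) * det (cols2 C D) = 0"
    unfolding AD BC using det[of D] by (simp add: stripe_total_def left_diff_distrib)
  then have mn: "q * n = m * L" using CD by (simp add: algebra_simps)
  \<comment> \<open>The factor \<open>L\<close> clears the denominator in n = m L / q: by
    \<open>mn\<close>, the column counts can be expressed through \<open>m * L\<close> and
    \<open>q * L\<close>.\<close>
  have "L * (A $ e * (q - m)\<^sup>2 + (B $ e + C $ e) * (q - m) * m + D $ e * m\<^sup>2) =
      (q - m) * (q * L - m * L) * A $ e + m * (q * L - m * L) * B $ e +
      (q - m) * (m * L) * C $ e + m * (m * L) * D $ e"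
    by (simp add: power2_eq_square algebra_simps)
  also have "\<dots> = q * stripe_total (A $ e) (B $ e) (C $ e) (D $ e) q L m n"
    unfolding mn[symmetric] by (simp add: stripe_total_def algebra_simps)
  finally have "A $ e * (q - m)\<^sup>2 + (B $ e + C $ e) * (q - m) * m + D $ e * m\<^sup>2 = 0"
    using zero pos by simp
  \<comment> \<open>\<open>q - m\<close> and \<open>m\<close> add up to \<open>q > 0\<close>, so
    they are not both 0.\<close>
  then show ?thesis by (rule is_square_discriminant) (use pos in auto)
qed

text \<open>A discrete divergence theorem: differences of \<open>V\<close> telescope along rows,
  those of \<open>H\<close> along columns. The corner \<open>(x, y)\<close> is arbitrary because
  pigeonhole does not control where its rectangle lies.\<close>

lemma rectangle_boundary_sum:
  fixes V H :: "int \<Rightarrow> int \<Rightarrow> real"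
  assumes step: "\<And>i j. V (i + 1) j - V i j + H i (j + 1) - H i j =
      stripe_total a b c d 1 1 (r j) (k i)"
  shows "stripe_total a b c d (of_nat q) (of_nat L)
           (\<Sum>j<q. r (y + int j)) (\<Sum>i<L. k (x + int i)) =
         (\<Sum>j<q. V (x + int L) (y + int j) - V x (y + int j)) +
         (\<Sum>i<L. H (x + int i) (y + int q) - H (x + int i) y)"
proof -
  have V: "(\<Sum>i<L. V (x + int i + 1) s - V (x + int i) s) = V (x + int L) s - V x s" for s
    using sum_lessThan_telescope[of "\<lambda>i. V (x + int i) s" L] by (simp add: add_ac)
  have H: "(\<Sum>j<q. H s (y + int j + 1) - H s (y + int j)) = H s (y + int q) - H s y" for s
    using sum_lessThan_telescope[of "\<lambda>j. H s (y + int j)" q] by (simp add: add_ac)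
  have "stripe_total a b c d (of_nat q) (of_nat L)
           (\<Sum>j<q. r (y + int j)) (\<Sum>i<L. k (x + int i)) =
        (\<Sum>i<L. \<Sum>j<q. (V (x + int i + 1) (y + int j) - V (x + int i) (y + int j)) +
            (H (x + int i) (y + int j + 1) - H (x + int i) (y + int j)))"
    unfolding sum_stripe_total[symmetric] step[symmetric] by (simp add: algebra_simps)
  also have "\<dots> = (\<Sum>j<q. \<Sum>i<L. V (x + int i + 1) (y + int j) - V (x + int i) (y + int j)) +
      (\<Sum>i<L. \<Sum>j<q. H (x + int i) (y + int j + 1) - H (x + int i) (y + int j))"
    unfolding sum.distrib by (subst sum.swap) simp
  finally show ?thesis unfolding V H .
qed

section \<open>Periodicity, repeated columns and rectangles of total zero\<close>

lemma periodic_nat_abs: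
  fixes f :: "int \<Rightarrow> 'a"
  assumes "\<And>i. f (i + p) = f i"
  shows "f (i + int (nat \<bar>p\<bar>)) = f i"
  using assms[of i] assms[of "i - p"] by (cases "p \<ge> 0") (simp_all add: abs_if)

lemma sum_periodic:
  fixes f :: "int \<Rightarrow> 'a::comm_ring_1"
  assumes "\<And>i. f (i + int p) = f i"
  shows "(\<Sum>i<M * p. f (int i)) = of_nat M * (\<Sum>i<p. f (int i))"
proof (induction M)
  case (Suc M)
  have shift: "f (int (i + M * p)) = f (int i)" for i
  proof (induction M)
    case (Suc M)
    then show ?case using assms[of "int (i + M * p)"] by (simp add: algebra_simps)
  qed simp
  \<comment> \<open>In blocks of length \<open>p\<close>, the ranges for \<open>Suc M\<close> and
    \<open>M\<close> differ by the last block.\<close>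
  have "(\<Sum>i<Suc M * p. f (int i)) =
      (\<Sum>i<M * p. f (int i)) + (\<Sum>i<p. f (int (i + M * p)))"
    using sum.nat_group[of "\<lambda>i. f (int i)" p "Suc M"] sum.nat_group[of "\<lambda>i. f (int i)" p M]
      sum.shift_bounds_nat_ivl[of "\<lambda>i. f (int i)" 0 "M * p" p]
    by (simp add: lessThan_atLeast0 add.commute)
  then show ?case using Suc unfolding shift by (simp add: algebra_simps)
qed simp

text \<open>Pigeonhole: there are infinitely many columns of height \<open>q\<close> but only
  finitely many words of length \<open>q\<close> over \<open>X\<close>. Using
  \<open>restrict\<close> makes these words elements of a finite function space.\<close>

lemma repeated_column:
  fixes f :: "int \<Rightarrow> int \<Rightarrow> 'a"
  assumes "finite X" "\<And>i j. f i j \<in> X"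
  obtains x and L :: nat where "L > 0" "\<And>j. j < q \<Longrightarrow> f (x + int L) (int j) = f x (int j)"
proof -
  define col where "col k = restrict (\<lambda>j. f (int k) (int j)) {..<q}" for k :: nat
  have "range col \<subseteq> {..<q} \<rightarrow>\<^sub>E X" using assms(2) by (auto simp: col_def split: if_splits)
  moreover have "finite ({..<q} \<rightarrow>\<^sub>E X)" using assms(1) by (intro finite_PiE) auto
  ultimately have "\<not> inj col" using finite_subset finite_imageD infinite_UNIV_nat by blast
  then obtain k l where "col k = col l" "k < l"
    unfolding inj_def by (metis linorder_neqE_nat)
  moreover have "f (int k) (int j) = f (int l) (int j)" if "j < q" for j
    using fun_cong[OF \<open>col k = col l\<close>, of j] that by (simp add: col_def)
  ultimately show thesis by (intro that[of "l - k" "int k"]) auto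
qed

text \<open>Only \<open>r\<close> and \<open>k\<close> have periods along the axes, so opposite
  sides need not cancel. Dilation by \<open>M\<close> multiplies the total by the square of
  \<open>M\<close>, whereas the boundary consists of \<open>M * (q + p)\<close> differences, each at
  most \<open>2 * K\<close> in absolute value.\<close>

lemma dilated_boundary_zero:
  fixes V H :: "int \<Rightarrow> int \<Rightarrow> real" and p q :: nat
  assumes step: "\<And>i j. V (i + 1) j - V i j + H i (j + 1) - H i j =
      stripe_total a b c d 1 1 (r j) (k i)"
    and bound: "\<And>i j. \<bar>V i j\<bar> \<le> K" "\<And>i j. \<bar>H i j\<bar> \<le> K"
    and per: "\<And>j. r (j + int q) = r j" "\<And>i. k (i + int p) = k i"
  shows "stripe_total a b c d (of_nat q) (of_nat p) (\<Sum>j<q. r (int j)) (\<Sum>i<p. k (int i)) = 0"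
    (is "?S = 0")
proof (rule ccontr)
  assume "?S \<noteq> 0"
  have bnd: "real M * \<bar>?S\<bar> \<le> 2 * K * real (q + p)" if "M > 0" for M
  proof -
    have "\<bar>(real M)\<^sup>2 * ?S\<bar> =
        \<bar>(\<Sum>j<M * q. V (int (M * p)) (int j) - V 0 (int j)) +
          (\<Sum>i<M * p. H (int i) (int (M * q)) - H (int i) 0)\<bar>"
      unfolding stripe_total_scale[symmetric]
      using rectangle_boundary_sum[where V = V and H = H, OF step, of "M * q" "M * p" 0 0]
      by (simp add: sum_periodic[of r q, OF per(1)] sum_periodic[of k p, OF per(2)])
    also have "\<dots> \<le> (\<Sum>j<M * q. \<bar>V (int (M * p)) (int j) - V 0 (int j)\<bar>) +
          (\<Sum>i<M * p. \<bar>H (int i) (int (M * q)) - H (int i) 0\<bar>)"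
      by (rule order.trans[OF abs_triangle_ineq add_mono[OF sum_abs sum_abs]])
    also have "\<dots> \<le> (\<Sum>j<M * q. 2 * K) + (\<Sum>i<M * p. 2 * K)"
    proof -
      have "\<bar>V i j - V i' j'\<bar> \<le> 2 * K" "\<bar>H i j - H i' j'\<bar> \<le> 2 * K" for i j i' j'
        using bound(1)[of i j] bound(1)[of i' j'] bound(2)[of i j] bound(2)[of i' j'] by linarith+
      then show ?thesis by (intro add_mono sum_mono)
    qed
    finally have "real M * (real M * \<bar>?S\<bar>) \<le> real M * (2 * K * real (q + p))"
      by (simp add: abs_mult power2_eq_square algebra_simps)
    then show ?thesis using that by simp
  qed
  obtain M where M: "2 * K * real (q + p) < real M * \<bar>?S\<bar>"
    using reals_Archimedean3[of "\<bar>?S\<bar>"] \<open>?S \<noteq> 0\<close> by auto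
  \<comment> \<open>Nonnegativity of \<open>K\<close> rules out \<open>M = 0\<close>, for which
    \<open>bnd\<close> says nothing.\<close>
  have "0 \<le> K" using bound(1)[of 0 0] by linarith
  then have "0 \<le> 2 * K * real (q + p)" by simp
  with M have "0 < M" by (cases M) auto
  from bnd[OF this] M show False by simp
qed

text \<open>One rectangle has to serve both coordinates \<open>e\<close>, so it is chosen from the
  colors and the period alone.\<close>

lemma periodic_zero_rectangle:
  fixes f :: "int \<Rightarrow> int \<Rightarrow> 'i" and g :: "int \<Rightarrow> int \<Rightarrow> 'j"
    and v :: "'i \<Rightarrow> real^2" and h :: "'j \<Rightarrow> real^2" and A B C D :: "int^2"
    and r k :: "int \<Rightarrow> int"
  assumes fin: "finite I" "finite J" and fI: "\<And>i j. f i j \<in> I" and gJ: "\<And>i j. g i j \<in> J"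
    and step: "\<And>i j e. (v (f (i + 1) j) - v (f i j) + h (g i (j + 1)) - h (g i j)) $ e =
        of_int (stripe_total (A $ e) (B $ e) (C $ e) (D $ e) 1 1 (r j) (k i))"
    and nz: "(p1, p2) \<noteq> (0, 0)"
    and per: "\<And>i j. f (i + p1) (j + p2) = f i j" "\<And>i j. g (i + p1) (j + p2) = g i j"
      "\<And>j. r (j + p2) = r j" "\<And>i. k (i + p1) = k i"
  obtains q L m n where "q > 0" "L > 0"
    "\<And>e. stripe_total (A $ e) (B $ e) (C $ e) (D $ e) q L m n = 0"
proof -
  have step': "v (f (i + 1) j) $ e - v (f i j) $ e + h (g i (j + 1)) $ e - h (g i j) $ e =
      stripe_total (of_int (A $ e)) (of_int (B $ e)) (of_int (C $ e)) (of_int (D $ e)) 1 1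
        (of_int (r j)) (of_int (k i))" for i j e
    using step[of i j e] by (simp add: of_int_stripe_total)
  note boundary = rectangle_boundary_sum[where V = "\<lambda>i j. v (f i j) $ e"
      and H = "\<lambda>i j. h (g i j) $ e" for e, OF step']
  consider "p1 = 0" "p2 \<noteq> 0" | "p1 \<noteq> 0" "p2 = 0" | "p1 \<noteq> 0" "p2 \<noteq> 0" using nz by auto
  then show thesis
  proof cases
    case 1
    \<comment> \<open>With a vertical period, bottom and top of every rectangle of height
      \<open>q\<close> agree; a repeated column makes left and right agree. The next case is the
      transpose.\<close>
    define q where "q = nat \<bar>p2\<bar>"
    have g: "g i (int q) = g i 0" for i
      using periodic_nat_abs[of "g i" p2 0] per(2)[of i] 1 by (simp add: q_def)
    obtain x and L :: nat where L: "L > 0" "\<And>j. j < q \<Longrightarrow> f (x + int L) (int j) = f x (int j)"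
      by (rule repeated_column[OF fin(1) fI, of q]) (rule that)
    have zero: "real_of_int (stripe_total (A $ e) (B $ e) (C $ e) (D $ e) (int q) (int L)
            (\<Sum>j<q. r (int j)) (\<Sum>i<L. k (x + int i))) = 0" for e
      using boundary[of e q L 0 x] by (simp add: of_int_stripe_total g L(2))
    show thesis
      by (rule that[OF _ _ zero[unfolded of_int_eq_0_iff]]) (use L(1) 1 in \<open>simp_all add: q_def\<close>)
  next
    case 2
    define L where "L = nat \<bar>p1\<bar>"
    have f: "f (int L) j = f 0 j" for j
      using periodic_nat_abs[of "\<lambda>i. f i j" p1 0] per(1)[of _ j] 2 by (simp add: L_def)
    obtain y and q :: nat where q: "q > 0" "\<And>i. i < L \<Longrightarrow> g (int i) (y + int q) = g (int i) y"
      by (rule repeated_column[where f = "\<lambda>j i. g i j", OF fin(2) gJ, of L]) (rule that)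
    have zero: "real_of_int (stripe_total (A $ e) (B $ e) (C $ e) (D $ e) (int q) (int L)
            (\<Sum>j<q. r (y + int j)) (\<Sum>i<L. k (int i))) = 0" for e
      using boundary[of e q L y 0] by (simp add: of_int_stripe_total f q(2))
    show thesis
      by (rule that[OF _ _ zero[unfolded of_int_eq_0_iff]]) (use q(1) 2 in \<open>simp_all add: L_def\<close>)
  next
    case 3
    \<comment> \<open>The colors repeat only diagonally, but \<open>r\<close> and \<open>k\<close>
      depend on one coordinate each and inherit the periods \<open>p2\<close> and
      \<open>p1\<close>.\<close>
    define q where "q = nat \<bar>p2\<bar>"
    define L where "L = nat \<bar>p1\<bar>"
    have zero: "real_of_int (stripe_total (A $ e) (B $ e) (C $ e) (D $ e) (int q) (int L)
            (\<Sum>j<q. r (int j)) (\<Sum>i<L. k (int i))) = 0" for e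
    proof -
      \<comment> \<open>Finiteness of the color sets gives a uniform bound on both
        potentials.\<close>
      define K where "K = (\<Sum>a\<in>I. \<bar>v a $ e\<bar>) + (\<Sum>b\<in>J. \<bar>h b $ e\<bar>)"
      have "\<bar>v (f i j) $ e\<bar> \<le> K" for i j
        using member_le_sum[OF fI[of i j], where f = "\<lambda>a. \<bar>v a $ e\<bar>"] fin(1)
        by (simp add: K_def add_increasing2 sum_nonneg)
      moreover have "\<bar>h (g i j) $ e\<bar> \<le> K" for i j
        using member_le_sum[OF gJ[of i j], where f = "\<lambda>b. \<bar>h b $ e\<bar>"] fin(2)
        by (simp add: K_def add_increasing sum_nonneg)
      moreover have "r (j + int q) = r j" for j
        unfolding q_def by (rule periodic_nat_abs[of r p2, OF per(3)])
      moreover have "k (i + int L) = k i" for i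
        unfolding L_def by (rule periodic_nat_abs[of k p1, OF per(4)])
      ultimately show ?thesis
        using dilated_boundary_zero[where V = "\<lambda>i j. v (f i j) $ e"
            and H = "\<lambda>i j. h (g i j) $ e", OF step', of K q L]
        by (simp add: of_int_stripe_total)
    qed
    show thesis
      by (rule that[OF _ _ zero[unfolded of_int_eq_0_iff]]) (use 3 in \<open>simp_all add: q_def L_def\<close>)
  qed
qed

section \<open>Row and column bits of a tiling\<close>

lemma const_if_step_int:
  fixes P :: "int \<Rightarrow> 'a"
  assumes "\<And>i. P (i + 1) = P i"
  shows "P i = P 0"
proof (induction i rule: int_induct[where k = 0])
  case (step2 i)
  then show ?case using assms[of "i - 1"] by simp
qed (simp_all add: assms)

theorem theorem1:
  fixes I I0 I1 :: "'i set" and J J0 J1 :: "'j set"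
    and T :: "('i, 'j) tile set"
    and A B C D :: "int^2"
  assumes "finite I" and "finite J"
    and "T \<subseteq> I \<times> J \<times> I \<times> J"
    and "has_stripes I I0 I1 J J0 J1 T"
    and "determines_quadrilateral I0 I1 J0 J1 T
           (int_point A) (int_point B) (int_point C) (int_point D)"
    and "det (cols2 A D) = 0"
    and "det (cols2 B D) = - det (cols2 C D)"
    and "det (cols2 C D) \<noteq> 0"
    and "\<exists>i :: 2. (B $ i + C $ i)\<^sup>2 - 4 * A $ i * D $ i > 0 \<and>
                  \<not> is_square ((B $ i + C $ i)\<^sup>2 - 4 * A $ i * D $ i)"
  shows "\<not> (\<exists>w. valid_config T w \<and> periodic_config w)"
proof
  assume "\<exists>w. valid_config T w \<and> periodic_config w"
  then obtain w p where w: "valid_config T w" and "p \<noteq> 0" and wp: "\<And>n. w (n + p) = w n"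
    unfolding periodic_config_def by blast
  obtain p1 p2 where p: "p = (p1, p2)" by (cases p)
  with \<open>p \<noteq> 0\<close> have nz: "(p1, p2) \<noteq> (0, 0)" by (simp add: zero_prod_def)
  have wper: "w (i + p1, j + p2) = w (i, j)" for i j using wp[of "(i, j)"] p by simp
  \<comment> \<open>West and south labels suffice: in a valid configuration the other two labels of
    a tile are those of its neighbours.\<close>
  define f where "f i j = west (w (i, j))" for i j
  define g where "g i j = south (w (i, j))" for i j
  have tile: "w (i, j) = (f (i + 1) j, g i (j + 1), f i j, g i j)" for i j
  proof -
    have "east (w (i, j)) = f (i + 1) j" "north (w (i, j)) = g i (j + 1)"
      using w by (auto simp: valid_config_def f_def g_def)
    then show ?thesis unfolding f_def g_def by (cases "w (i, j)") simp
  qed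
  have inT: "(f (i + 1) j, g i (j + 1), f i j, g i j) \<in> T" for i j
    using w tile[of i j] by (metis valid_config_def)
  have fI: "f i j \<in> I" and gJ: "g i j \<in> J" for i j using inT[of i j] assms(3) by auto
  have disj: "I0 \<inter> I1 = {}" "J0 \<inter> J1 = {}" using assms(4) by (auto simp: has_stripes_def)
  have stripe: "f (i + 1) j \<in> I0 \<and> f i j \<in> I0 \<or> f (i + 1) j \<in> I1 \<and> f i j \<in> I1"
    "g i (j + 1) \<in> J0 \<and> g i j \<in> J0 \<or> g i (j + 1) \<in> J1 \<and> g i j \<in> J1" for i j
    using assms(4) inT[of i j] unfolding has_stripes_def by blast+
  have row: "f i j \<in> I1 \<longleftrightarrow> f 0 j \<in> I1" for i j
    by (rule const_if_step_int) (use stripe(1) disj in blast)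
  have col: "g i j \<in> J1 \<longleftrightarrow> g i 0 \<in> J1" for i j
    by (rule const_if_step_int) (use stripe(2) disj in blast)
  define r :: "int \<Rightarrow> int" where "r j = of_bool (f 0 j \<in> I1)" for j
  define k :: "int \<Rightarrow> int" where "k i = of_bool (g i 0 \<in> J1)" for i
  obtain v :: "'i \<Rightarrow> real^2" and h :: "'j \<Rightarrow> real^2" where
    vh: "\<forall>(a, b, c, d) \<in> subtiles T I0 J0. v a + h b - v c - h d = int_point A"
      "\<forall>(a, b, c, d) \<in> subtiles T I1 J0. v a + h b - v c - h d = int_point B"
      "\<forall>(a, b, c, d) \<in> subtiles T I0 J1. v a + h b - v c - h d = int_point C"
      "\<forall>(a, b, c, d) \<in> subtiles T I1 J1. v a + h b - v c - h d = int_point D"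
    using assms(5) unfolding determines_quadrilateral_def by (elim exE conjE) (rule that)
  have step: "(v (f (i + 1) j) - v (f i j) + h (g i (j + 1)) - h (g i j)) $ e =
        of_int (stripe_total (A $ e) (B $ e) (C $ e) (D $ e) 1 1 (r j) (k i))" for i j e
  proof -
    let ?s = "v (f (i + 1) j) + h (g i (j + 1)) - v (f i j) - h (g i j)"
    have "?s = int_point (if f i j \<in> I1 then if g i j \<in> J1 then D else B
                          else if g i j \<in> J1 then C else A)"
      using inT[of i j] stripe[of i j] disj vh[THEN bspec, of "(f (i + 1) j, g i (j + 1), f i j, g i j)"]
      by (auto simp: subtiles_def)
    then have "?s $ e = of_int (stripe_total (A $ e) (B $ e) (C $ e) (D $ e) 1 1 (r j) (k i))"
      by (auto simp: r_def k_def row[of i j] col[of i j] stripe_total_def int_point_def)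
    then show ?thesis by (simp add: algebra_simps)
  qed
  have fper: "f (i + p1) (j + p2) = f i j" and gper: "g (i + p1) (j + p2) = g i j" for i j
    by (simp_all add: f_def g_def wper)
  \<comment> \<open>By \<open>row\<close>, the bit of row \<open>j + p2\<close> may be read in
    column \<open>p1\<close>, where the diagonal period applies.\<close>
  have rper: "r (j + p2) = r j" for j
    using row[of p1 "j + p2"] fper[of 0 j] by (simp add: r_def)
  have kper: "k (i + p1) = k i" for i
    using col[of "i + p1" p2] gper[of i 0] by (simp add: k_def)
  obtain q L m n where qL: "q > 0" "L > 0"
    and zero: "\<And>e. stripe_total (A $ e) (B $ e) (C $ e) (D $ e) q L m n = 0"
    by (rule periodic_zero_rectangle[where f = f and g = g and v = v and h = h
          and r = r and k = k, OF assms(1,2) fI gJ step nz fper gper rper kper])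
      (rule that)
  have "is_square ((B $ e + C $ e)\<^sup>2 - 4 * A $ e * D $ e)" for e
    by (rule is_square_if_stripe_total_zero[OF zero qL assms(6-8)])
  then show False using assms(9) by (elim exE conjE) (erule notE, assumption)
qed

end
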